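(* Let $K$ be an algebraically closed field of characteristic zero, $R=K[X,Y]$, $\mathfrak{m}=(X,Y)$, and let $m,n$ be positive integers. Let $i,j,t,x$ be admissible parameters. Suppose that $\nu$ is a rational rank $1$ non discrete valuation of $K(X,Y)$ dominating $R_{\mathfrak{m}}$ with generating sequence $Q_0=X,\ Q_1=Y,\ Q_2,\dots$ such that each $Q_l\in R$ is an eigenfunction for $H_{i,j,t,x}$. Let $A_{i,j,t,x}=R^{H_{i,j,t,x}}$ and $\mathfrak{n}=\mathfrak{m}\cap A_{i,j,t,x}$. Then $S^{(A_{i,j,t,x})_{\mathfrak{n}}}(\nu)$ is equal to the set of all $$l\gamma_0+j_1\gamma_1+\cdots+j_r\gamma_r$$ such that $l\in\mathbb{N}$, $r\in\mathbb{N}$, $j_1,\dots,j_r$ are integers with $0\le j_k<\overline{m_k}$ for all $k=1,\dots,r$, and $$\alpha^{lai}\,\beta^{\,bj\sum_{k=1}^r j_k d(k)}=1\quad\text{for all integers } a,b \text{ with } b\equiv ax \pmod t.$$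
   Context: $\mathbb{N}=\{0,1,2,\dots\}$. Groups. Let $\alpha\in K$ be a primitive $m$-th root of unity, $\beta\in K$ a primitive $n$-th root of unity, $\mathbb{U}_m=\langle\alpha\rangle$, $\mathbb{U}_n=\langle\beta\rangle$. Positive integers $i,j,t,x$ are admissible if $i\mid m$, $j\mid n$, $t\mid \frac{m}{i}$, $t\mid\frac{n}{j}$, $\gcd(x,t)=1$ and $1\le x\le t$. For these, $H_{i,j,t,x}=\{(\alpha^{ai},\beta^{bj}) : a,b\in\mathbb{Z},\ b\equiv ax \pmod t\}$, a subgroup of $\mathbb{U}_m\times\mathbb{U}_n$ (every subgroup has this form). Action. $\mathbb{U}_m\times\mathbb{U}_n$ acts on $R$ by $K$-algebra automorphisms with $(\alpha^p,\beta^q)\cdot X=\alpha^pX$ and $(\alpha^p,\beta^q)\cdot Y=\beta^qY$. $R^{H_{i,j,t,x}}$ is the ring of invariants. An element $f\in R$ is an eigenfunction for $H_{i,j,t,x}$ if for every $g\in H_{i,j,t,x}$ there is $\lambda_g\in K$ with $g\cdot f=\lambda_g f$. Valuations. $\nu$ is a valuation of $K(X,Y)$ with value group $\Phi_\nu$; it dominates a local ring if its valuation ring contains that ring and the maximal ideal of the valuation ring contracts to the maximal ideal of the ring. Rational rank $1$ means $\Phi_\nu\otimes\mathbb{Q}\cong\mathbb{Q}$ (so $\Phi_\nu$ is regarded as an ordered subgroup of $\mathbb{Q}$), and non discrete means $\Phi_\nu\not\cong\mathbb{Z}$. For a local domain $B\subset K(X,Y)$ dominated by $\nu$, $S^{B}(\nu)=\{\nu(f):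 0\ne f\in B\}$. The generating sequence of $\nu$ is the sequence $(Q_l)_{l\ge0}$ in $R$ produced by the algorithm of Cutkosky and Vinh: $Q_0=X$, $Q_1=Y$, $\gamma_l=\nu(Q_l)$; for $l\ge1$, $\overline{m_l}=\min\{q\in\mathbb{Z}_{>0}: q\gamma_l\in \sum_{k=0}^{l-1}\gamma_k\mathbb{Z}\}$, and $Q_{l+1}=Q_l^{\overline{m_l}}-\lambda_l X^{c_0}Y^{c_1}Q_2^{c_2}\cdots Q_{l-1}^{c_{l-1}}$, where $\overline{m_l}\gamma_l=\sum_{k=0}^{l-1}c_k\gamma_k$ is the unique representation with $c_0\in\mathbb{N}$ and $0\le c_k<\overline{m_k}$ for $1\le k\le l-1$, and $\lambda_l\in K\setminus\{0\}$ is the unique element such that $\nu(Q_{l+1})>\overline{m_l}\gamma_l$. It has the following properties: (1) $\gamma_{l+1}>\overline{m_l}\gamma_l$ for $l\ge1$; (2) $Q_l$ ($l\ge1$) is monic in $Y$ of degree $d(l)=\deg_Y Q_l$, with $d(1)=1$ and $d(l)=\prod_{k=1}^{l-1}\overline{m_k}$ for $l\ge2$; (3) every $f\in R$ with $\deg_Y f=d$ has a unique expression $f=\sum_{e=0}^{d} f_e$, $f_e=(\sum_l b_{l,e}X^l)Q_1^{j_1(e)}\cdots Q_r^{j_r(e)}$ with $b_{l,e}\in K$, $0\le j_k(e)<\overline{m_k}$, $\deg_Y(Q_1^{j_1(e)}\cdots Q_r^{j_r(e)})=e$; the values of distinct nonzero $f_e$ are distinct, so $\nu(f)=\min_e\nu(f_e)$;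 (4) $S^{R_{\mathfrak{m}}}(\nu)=\sum_{l\ge0}\gamma_l\mathbb{N}$. *)

theory Defs
  imports
    "HOL-Computational_Algebra.Computational_Algebra"
    "HOL-Number_Theory.Cong"
begin

section \<open>The polynomial ring and its function field\<close>

text \<open>
  \<open>K[X,Y]\<close> is \<open>K[X][Y]\<close>, the type \<open>'a poly poly\<close>: the outer variable is \<open>Y\<close>,
  so \<open>degree f\<close> is the degree of \<open>f\<close> in \<open>Y\<close>. The function field \<open>K(X,Y)\<close> is
  \<open>'a poly poly fract\<close>.
\<close>

definition varX :: "'a::field poly poly" where
  "varX = [:[:0, 1:]:]"

definition varY :: "'a::field poly poly" where
  "varY = [:0, 1:]"

definition const2 :: "'a::field \<Rightarrow> 'a poly poly" where
  "const2 c = [:[:c:]:]"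

definition max_ideal_XY :: "'a::field poly poly set" where
  "max_ideal_XY = {f * varX + g * varY | f g. True}"

definition embed :: "'a::field poly poly \<Rightarrow> 'a poly poly fract" where
  "embed f = Fraction_Field.Fract f 1"

text \<open>Localization of a subring \<open>A\<close> of \<open>K[X,Y]\<close> at a prime ideal \<open>P\<close> of \<open>A\<close>.\<close>

definition localize ::
    "'a::field poly poly set \<Rightarrow> 'a poly poly set \<Rightarrow> 'a poly poly fract set" where
  "localize A P = {embed f / embed g | f g. f \<in> A \<and> g \<in> A \<and> g \<notin> P}"

section \<open>The groups and their action\<close>

definition primitive_root_of_unity :: "nat \<Rightarrow> 'a::field \<Rightarrow> bool" where
  "primitive_root_of_unity m \<alpha> \<longleftrightarrow>
     m > 0 \<and> \<alpha> ^ m = 1 \<and> (\<forall>k. 0 < k \<and> k < m \<longrightarrow> \<alpha> ^ k \<noteq> 1)"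

definition admissible :: "nat \<Rightarrow> nat \<Rightarrow> nat \<Rightarrow> nat \<Rightarrow> nat \<Rightarrow> nat \<Rightarrow> bool" where
  "admissible m n i j t x \<longleftrightarrow>
     i > 0 \<and> j > 0 \<and> t > 0 \<and> i dvd m \<and> j dvd n \<and> t dvd m div i \<and> t dvd n div j \<and>
     coprime x t \<and> 1 \<le> x \<and> x \<le> t"

definition grpH :: "'a::field \<Rightarrow> 'a \<Rightarrow> nat \<Rightarrow> nat \<Rightarrow> nat \<Rightarrow> nat \<Rightarrow> ('a \<times> 'a) set" where
  "grpH \<alpha> \<beta> i j t x =
     {(\<alpha> powi (a * int i), \<beta> powi (b * int j)) | a b. [b = a * int x] (mod int t)}"

text \<open>The \<open>K\<close>-algebra endomorphism with \<open>X \<mapsto> uX\<close>, \<open>Y \<mapsto> vY\<close>, i.e.\ \<open>f \<mapsto> f(uX, vY)\<close>.\<close>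

definition act :: "'a::field \<times> 'a \<Rightarrow> 'a poly poly \<Rightarrow> 'a poly poly" where
  "act g f = pcompose (map_poly (\<lambda>c. pcompose c [:0, fst g:]) f) [:0, [:snd g:]:]"

definition invariant_ring :: "('a::field \<times> 'a) set \<Rightarrow> 'a poly poly set" where
  "invariant_ring H = {f. \<forall>g\<in>H. act g f = f}"

definition eigenfunction :: "('a::field \<times> 'a) set \<Rightarrow> 'a poly poly \<Rightarrow> bool" where
  "eigenfunction H f \<longleftrightarrow> (\<forall>g\<in>H. \<exists>c. act g f = const2 c * f)"

section \<open>Valuations\<close>

text \<open>
  Valuations are written additively and take values in \<open>\<rat>\<close>, since a value group of rational
  rank \<open>1\<close> is regarded as an ordered subgroup of \<open>\<rat>\<close>. The value at \<open>0\<close> (mathematically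
  \<open>\<infinity>\<close>) is left unconstrained; it is never used, as the members of a generating sequence are nonzero.
\<close>

definition is_valuation :: "('f::field \<Rightarrow> rat) \<Rightarrow> bool" where
  "is_valuation \<nu> \<longleftrightarrow>
     (\<forall>f g. f \<noteq> 0 \<longrightarrow> g \<noteq> 0 \<longrightarrow> \<nu> (f * g) = \<nu> f + \<nu> g) \<and>
     (\<forall>f g. f \<noteq> 0 \<longrightarrow> g \<noteq> 0 \<longrightarrow> f + g \<noteq> 0 \<longrightarrow> \<nu> (f + g) \<ge> min (\<nu> f) (\<nu> g))"

definition valuation_ring :: "('f::field \<Rightarrow> rat) \<Rightarrow> 'f set" where
  "valuation_ring \<nu> = {z. z = 0 \<or> \<nu> z \<ge> 0}"

definition valuation_ideal :: "('f::field \<Rightarrow> rat) \<Rightarrow> 'f set" where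
  "valuation_ideal \<nu> = {z. z = 0 \<or> \<nu> z > 0}"

definition value_group :: "('f::field \<Rightarrow> rat) \<Rightarrow> rat set" where
  "value_group \<nu> = \<nu> ` (UNIV - {0})"

text \<open>
  For a subgroup \<open>\<Phi>\<close> of \<open>\<rat>\<close>, the space \<open>\<Phi> \<otimes> \<rat>\<close> is the \<open>\<rat>\<close>-linear span of \<open>\<Phi>\<close> in \<open>\<rat>\<close>.
\<close>

definition rational_rank :: "('f::field \<Rightarrow> rat) \<Rightarrow> nat" where
  "rational_rank \<nu> = vector_space.dim ((*) :: rat \<Rightarrow> rat \<Rightarrow> rat) (value_group \<nu>)"

definition discrete_valuation :: "('f::field \<Rightarrow> rat) \<Rightarrow> bool" where
  "discrete_valuation \<nu> \<longleftrightarrow>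
     (\<exists>\<phi> :: int \<Rightarrow> rat. bij_betw \<phi> UNIV (value_group \<nu>) \<and> (\<forall>a b. \<phi> (a + b) = \<phi> a + \<phi> b))"

text \<open>The maximal ideal of a local ring \<open>B\<close> is its set of non-units.\<close>

definition nonunits :: "'f::field set \<Rightarrow> 'f set" where
  "nonunits B = {z \<in> B. \<not> (\<exists>w\<in>B. z * w = 1)}"

definition dominates :: "('f::field \<Rightarrow> rat) \<Rightarrow> 'f set \<Rightarrow> bool" where
  "dominates \<nu> B \<longleftrightarrow> B \<subseteq> valuation_ring \<nu> \<and> valuation_ideal \<nu> \<inter> B = nonunits B"

definition value_semigroup :: "('f::field \<Rightarrow> rat) \<Rightarrow> 'f set \<Rightarrow> rat set" where
  "value_semigroup \<nu> B = \<nu> ` (B - {0})"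

section \<open>Generating sequences\<close>

definition gam ::
    "('a::field poly poly fract \<Rightarrow> rat) \<Rightarrow> (nat \<Rightarrow> 'a poly poly) \<Rightarrow> nat \<Rightarrow> rat" where
  "gam \<nu> Q l = \<nu> (embed (Q l))"

definition mbar ::
    "('a::field poly poly fract \<Rightarrow> rat) \<Rightarrow> (nat \<Rightarrow> 'a poly poly) \<Rightarrow> nat \<Rightarrow> nat" where
  "mbar \<nu> Q l =
     (LEAST q. q > 0 \<and>
        of_nat q * gam \<nu> Q l \<in> {\<Sum>k<l. gam \<nu> Q k * of_int (z k) | z :: nat \<Rightarrow> int. True})"

text \<open>
  The exponents \<open>c k\<close> (\<open>k < l\<close>) and the scalar \<open>s\<close> are uniquely determined by the conditions
  imposed on them, so stating their existence pins down the sequence. Since \<open>Q 0 = X\<close> and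
  \<open>Q 1 = Y\<close>, the product over \<open>k < l\<close> is \<open>X\<^sup>c\<^sup>0 Y\<^sup>c\<^sup>1 Q\<^sub>2\<^sup>c\<^sup>2 \<dots>\<close>, with no bound on \<open>c 0\<close>.
\<close>

definition generating_sequence ::
    "('a::field poly poly fract \<Rightarrow> rat) \<Rightarrow> (nat \<Rightarrow> 'a poly poly) \<Rightarrow> bool" where
  "generating_sequence \<nu> Q \<longleftrightarrow>
     Q 0 = varX \<and> Q 1 = varY \<and>
     (\<forall>l\<ge>1. \<exists>(c :: nat \<Rightarrow> nat) s.
        (\<forall>k. 1 \<le> k \<and> k < l \<longrightarrow> c k < mbar \<nu> Q k) \<and>
        of_nat (mbar \<nu> Q l) * gam \<nu> Q l = (\<Sum>k<l. of_nat (c k) * gam \<nu> Q k) \<and>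
        s \<noteq> 0 \<and>
        Q (Suc l) = Q l ^ mbar \<nu> Q l - const2 s * (\<Prod>k<l. Q k ^ c k) \<and>
        gam \<nu> Q (Suc l) > of_nat (mbar \<nu> Q l) * gam \<nu> Q l)"

end

theory Submission
  imports Defs
begin

text \<open>
  The monomials \<open>X\<^sup>l \<Prod> Q\<^sub>k\<^sup>j\<^sub>k\<close> with \<open>j\<^sub>k < mbar k\<close> form a \<open>K\<close>-basis of \<open>K[X,Y]\<close>, their values are
  pairwise distinct, and each is an eigenfunction of the group. So the value of an invariant
  polynomial is the value of an invariant monomial. Denominators in the localization are units of
  the local ring at the origin and have value \<open>0\<close>. That the \<open>Q\<^sub>k\<close> reach every degree in \<open>Y\<close> needs
  the valuation to be non-discrete.
\<close>

section \<open>Polynomials and the torus action\<close>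

lemma embed_add: "embed (f + g) = embed f + embed g"
  by (simp add: embed_def)

lemma embed_mult: "embed (f * g) = embed f * embed g"
  by (simp add: embed_def)

lemma embed_0 [simp]: "embed 0 = 0"
  by (simp add: embed_def Zero_fract_def)

lemma embed_1 [simp]: "embed 1 = 1"
  by (simp add: embed_def One_fract_def)

lemma embed_eq_iff: "embed f = embed g \<longleftrightarrow> f = g"
  by (simp add: embed_def eq_fract)

lemma embed_eq_0_iff [simp]: "embed f = 0 \<longleftrightarrow> f = 0"
  using embed_eq_iff[of f 0] by simp

lemma fract_eq_embed_quotient:
  obtains f g where "g \<noteq> 0" "z = embed f / embed g"
proof (cases z rule: Fract_cases)
  case (Fract a b)
  then show ?thesis
    by (intro that[of b a]) (simp_all add: embed_def)
qed

section \<open>The maximal ideal at the origin\<close>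

lemma coeff_0_0_max_ideal:
  assumes "f \<in> max_ideal_XY"
  shows "coeff (coeff f 0) 0 = 0"
  using assms by (auto simp: max_ideal_XY_def varX_def varY_def coeff_mult_0)

lemma max_ideal_XY_mult:
  assumes "f \<in> max_ideal_XY"
  shows "f * h \<in> max_ideal_XY"
proof -
  obtain a b where "f = a * varX + b * varY"
    using assms by (auto simp: max_ideal_XY_def)
  then have "f * h = (a * h) * varX + (b * h) * varY"
    by (simp add: algebra_simps)
  then show ?thesis
    unfolding max_ideal_XY_def by blast
qed

lemma varX_in_max_ideal: "varX \<in> max_ideal_XY"
  unfolding max_ideal_XY_def by (intro CollectI exI[of _ 1] exI[of _ 0]) simp

lemma varY_in_max_ideal: "varY \<in> max_ideal_XY"
  unfolding max_ideal_XY_def by (intro CollectI exI[of _ 0] exI[of _ 1]) simp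

lemma zero_in_max_ideal: "0 \<in> max_ideal_XY"
  unfolding max_ideal_XY_def by (intro CollectI exI[of _ 0]) simp

section \<open>The action in terms of coefficients\<close>

lemma coeff_pcompose_scale: "coeff (pcompose p [:0, c:]) k = c ^ k * coeff p k"
  for p :: "'a::comm_semiring_1 poly"
proof (induction p arbitrary: k)
  case (pCons a p)
  then show ?case
    by (cases k) (simp_all add: pcompose_pCons mult.assoc)
qed simp

text \<open>Identities for \<open>act\<close> reduce through this to comparing coefficients of
  powers of \<open>Y\<close>.\<close>

lemma coeff_act: "coeff (act (u, v) f) n = smult (v ^ n) (pcompose (coeff f n) [:0, u:])"
proof -
  have "[:v:] ^ n = [:v ^ n:]"
    by (induction n) (simp_all add: one_pCons)
  then show ?thesis
    by (simp add: act_def coeff_pcompose_scale coeff_map_poly)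
qed

lemma act_diff: "act g (f - h) = act g f - act g h"
  by (cases g) (simp add: poly_eq_iff coeff_act pcompose_diff smult_diff_right)

lemma smult_sum_right: "smult a (\<Sum>i\<in>S. f i) = (\<Sum>i\<in>S. smult a (f i))"
  by (induction S rule: infinite_finite_induct) (simp_all add: smult_add_right)

lemma act_mult: "act g (f * h) = act g f * act g h"
proof (cases g)
  case (Pair u v)
  have "coeff (act (u, v) (f * h)) n = coeff (act (u, v) f * act (u, v) h) n" for n
  proof -
    have "coeff (act (u, v) (f * h)) n =
        (\<Sum>i\<le>n. smult (v ^ n) (pcompose (coeff f i) [:0, u:] * pcompose (coeff h (n - i)) [:0, u:]))"
      by (simp add: coeff_act coeff_mult pcompose_sum pcompose_mult smult_sum_right)
    \<comment> \<open>The factor \<open>v ^ n\<close> splits as \<open>v ^ i * v ^ (n - i)\<close>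
      in each summand.\<close>
    also have "\<dots> = coeff (act (u, v) f * act (u, v) h) n"
      unfolding coeff_mult
      by (intro sum.cong) (auto simp: coeff_act simp flip: power_add)
    finally show ?thesis .
  qed
  then show ?thesis
    using Pair by (simp add: poly_eq_iff)
qed

lemma act_const: "act (u, v) [:p:] = [:pcompose p [:0, u:]:]"
  by (simp add: poly_eq_iff coeff_act coeff_pCons split: nat.split)

lemma act_1 [simp]: "act g 1 = 1"
  by (cases g) (simp add: act_const pcompose_1 one_pCons)

lemma act_power: "act g (f ^ n) = act g f ^ n"
  by (induction n) (simp_all add: act_mult)

lemma act_prod: "act g (\<Prod>k\<in>S. f k) = (\<Prod>k\<in>S. act g (f k))"
  by (induction S rule: infinite_finite_induct) (simp_all add: act_mult)

lemma const2_1 [simp]: "const2 1 = 1"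
  by (simp add: const2_def one_pCons)

lemma const2_mult: "const2 (a * b) = const2 a * const2 b"
  by (simp add: const2_def)

lemma const2_power: "const2 (a ^ n) = const2 a ^ n"
  by (induction n) (simp_all add: const2_mult)

lemma const2_prod: "const2 (\<Prod>k\<in>S. a k) = (\<Prod>k\<in>S. const2 (a k))"
  by (induction S rule: infinite_finite_induct) (simp_all add: const2_mult)

lemma act_varX_power: "act (u, v) (varX ^ l) = const2 (u ^ l) * varX ^ l"
  by (simp add: act_power varX_def act_const pcompose_pCons const2_power
      flip: power_mult_distrib) (simp add: const2_def)

text \<open>The eigenvalue is read off the leading coefficient in \<open>Y\<close>.\<close>

lemma eigenvalue_monic:
  assumes "eigenfunction H f" "(u, v) \<in> H" "lead_coeff f = 1"
  shows "act (u, v) f = const2 (v ^ degree f) * f"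
proof -
  obtain c where c: "act (u, v) f = const2 c * f"
    using assms by (auto simp: eigenfunction_def)
  have "[:v ^ degree f:] = coeff (act (u, v) f) (degree f)"
    using assms(3) by (simp add: coeff_act pcompose_1 flip: smult_one)
  also have "\<dots> = [:c:]"
    using assms(3) by (simp add: c const2_def)
  finally show ?thesis
    using c by simp
qed

text \<open>The coefficients form only a domain, so this is pseudo-division; its multiplier is a
  power of the leading coefficient, hence 1.\<close>

lemma monic_division:
  fixes f g :: "'a::idom poly"
  assumes "lead_coeff g = 1"
  obtains q r where "f = g * q + r" "r = 0 \<or> degree r < degree g"
proof -
  have "g \<noteq> 0"
    using assms by auto
  then show ?thesis
    using pseudo_divmod[of g f] assms that by (metis power_one smult_1_left surj_pair)
qed

section \<open>Discrete subgroups of the rationals\<close>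

text \<open>The product of the finitely many denominators clears all of them.\<close>

lemma rat_in_Ints_common_multiple:
  fixes w :: "nat \<Rightarrow> rat"
  obtains D :: int where "D > 0" "\<And>k. k \<le> L \<Longrightarrow> of_int D * w k \<in> \<int>"
proof -
  have "\<exists>D::int. D > 0 \<and> (\<forall>k<n. of_int D * w k \<in> \<int>)" for n
  proof (induction n)
    case 0
    then show ?case by (intro exI[of _ 1]) simp
  next
    case (Suc n)
    then obtain D :: int where D: "D > 0" "\<forall>k<n. of_int D * w k \<in> \<int>"
      by blast
    obtain p q where pq: "quotient_of (w n) = (p, q)"
      by fastforce
    have q: "q > 0" "w n = of_int p / of_int q"
      using pq quotient_of_denom_pos quotient_of_div by blast+
    have n: "of_int (q * D) * w n \<in> \<int>"
    proof -
      have "of_int (q * D) * w n = of_int (D * p)"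
        using q by simp
      then show ?thesis by (metis Ints_of_int)
    qed
    have "of_int (q * D) * w k \<in> \<int>" if "k < n" for k
    proof -
      have "of_int q * (of_int D * w k) \<in> \<int>"
        using that D(2) by (blast intro: Ints_mult[OF Ints_of_int])
      then show ?thesis
        by (simp only: of_int_mult mult.assoc)
    qed
    with n q D show ?case
      by (intro exI[of _ "q * D"]) (auto simp: less_Suc_eq)
  qed
  from this[of "Suc L"] show ?thesis
    using that by (auto simp: less_Suc_eq_le)
qed

text \<open>Bounded denominators force a least positive element \<open>g\<close>, and division with
  remainder by \<open>g\<close> shows that it generates \<open>G\<close>.\<close>

lemma additive_subgroup_discrete:
  fixes G :: "rat set" and D :: int
  assumes "D > 0" and D: "\<And>z. z \<in> G \<Longrightarrow> of_int D * z \<in> \<int>"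
    and diff: "\<And>y z. y \<in> G \<Longrightarrow> z \<in> G \<Longrightarrow> y - z \<in> G"
    and "y \<in> G" "y > 0"
  shows "\<exists>\<phi> :: int \<Rightarrow> rat. bij_betw \<phi> UNIV G \<and> (\<forall>a b. \<phi> (a + b) = \<phi> a + \<phi> b)"
proof -
  \<comment> \<open>Positive elements are encoded by their numerators over \<open>D\<close>, which
    makes the well-ordering of the naturals available.\<close>
  define P where "P = (\<lambda>k. k > 0 \<and> of_nat k / of_int D \<in> G)"
  have PI: "\<exists>k. P k \<and> z = of_nat k / of_int D" if z: "z \<in> G" "z > 0" for z
  proof -
    obtain a where a: "of_int D * z = of_int a"
      using D[OF z(1)] by (auto elim: Ints_cases)
    have "of_int a > (0::rat)"
      using a z \<open>D > 0\<close> by (metis of_int_0_less_iff zero_less_mult_iff)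
    then have "a > 0" by simp
    moreover have "z = of_int a / of_int D"
      using a \<open>D > 0\<close> by (simp add: field_simps)
    ultimately show ?thesis
      using z by (intro exI[of _ "nat a"]) (auto simp: P_def)
  qed
  define k where "k = (LEAST k. P k)"
  have k: "P k"
    unfolding k_def using PI[OF \<open>y \<in> G\<close> \<open>y > 0\<close>] by (metis LeastI)
  define g where "g = (of_nat k / of_int D :: rat)"
  have g: "g \<in> G" "g > 0"
    using k \<open>D > 0\<close> by (auto simp: P_def g_def)
  have g_le: "g \<le> z" if "z \<in> G" "z > 0" for z
  proof -
    obtain k' where "P k'" "z = of_nat k' / of_int D"
      using PI[OF \<open>z \<in> G\<close> \<open>z > 0\<close>] by blast
    moreover from this have "k \<le> k'"
      unfolding k_def by (simp add: Least_le)
    ultimately show ?thesis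
      using \<open>D > 0\<close> by (simp add: g_def divide_right_mono)
  qed
  have zero: "0 \<in> G"
    using diff[OF g(1) g(1)] by simp
  have minus: "- z \<in> G" if "z \<in> G" for z
    using diff[OF zero that] by simp
  have add: "z + w \<in> G" if "z \<in> G" "w \<in> G" for z w
    using diff[OF that(1) minus[OF that(2)]] by simp
  have nat_mult: "of_nat n * g \<in> G" for n
    by (induction n) (auto simp: zero g add algebra_simps)
  have int_mult: "of_int a * g \<in> G" for a
  proof (cases "a \<ge> 0")
    case True
    then show ?thesis using nat_mult[of "nat a"] by simp
  next
    case False
    then show ?thesis using minus[OF nat_mult[of "nat (- a)"]] by simp
  qed
  have "z \<in> range (\<lambda>a::int. of_int a * g)" if "z \<in> G" for z
  proof -
    \<comment> \<open>The remainder of \<open>z\<close> after \<open>a\<close> copies of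
      \<open>g\<close> lies in \<open>[0, g)\<close>, so minimality of \<open>g\<close> makes it
      vanish.\<close>
    define a where "a = \<lfloor>z / g\<rfloor>"
    have "z - of_int a * g \<in> G"
      using that int_mult diff by blast
    moreover have "of_int a \<le> z / g" "z / g < of_int a + 1"
      unfolding a_def by linarith+
    then have "z - of_int a * g \<ge> 0" "z - of_int a * g < g"
      using g(2) by (auto simp: field_simps)
    ultimately have "z - of_int a * g = 0"
      using g_le by force
    then show ?thesis by auto
  qed
  then have "bij_betw (\<lambda>a::int. of_int a * g) UNIV G"
    using g int_mult by (auto simp: bij_betw_def inj_on_def)
  then show ?thesis
    by (intro exI[of _ "\<lambda>a. of_int a * g"]) (simp add: algebra_simps)
qed

section \<open>Valuations dominating the local ring at the origin\<close>

locale dominating_valuation =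
  fixes \<nu> :: "'a::field poly poly fract \<Rightarrow> rat"
  assumes valuation: "is_valuation \<nu>"
    and dominates: "dominates \<nu> (localize UNIV max_ideal_XY)"
begin

definition val :: "'a poly poly \<Rightarrow> rat" where
  "val f = \<nu> (embed f)"

lemma \<nu>_mult: "f \<noteq> 0 \<Longrightarrow> g \<noteq> 0 \<Longrightarrow> \<nu> (f * g) = \<nu> f + \<nu> g"
  using valuation by (simp add: is_valuation_def)

lemma \<nu>_1: "\<nu> 1 = 0"
  using \<nu>_mult[of 1 1] by simp

lemma \<nu>_divide: "f \<noteq> 0 \<Longrightarrow> g \<noteq> 0 \<Longrightarrow> \<nu> (f / g) = \<nu> f - \<nu> g"
  using \<nu>_mult[of "f / g" g] by simp

lemma val_mult: "f \<noteq> 0 \<Longrightarrow> g \<noteq> 0 \<Longrightarrow> val (f * g) = val f + val g"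
  by (simp add: val_def embed_mult \<nu>_mult)

lemma val_1 [simp]: "val 1 = 0"
  by (simp add: val_def \<nu>_1)

lemma val_power: "f \<noteq> 0 \<Longrightarrow> val (f ^ n) = of_nat n * val f"
  by (induction n) (simp_all add: val_mult algebra_simps)

lemma val_prod:
  "(\<And>k. k \<in> S \<Longrightarrow> f k \<noteq> 0) \<Longrightarrow> val (\<Prod>k\<in>S. f k) = (\<Sum>k\<in>S. val (f k))"
  by (induction S rule: infinite_finite_induct) (simp_all add: val_mult)

lemma val_add: "f \<noteq> 0 \<Longrightarrow> g \<noteq> 0 \<Longrightarrow> f + g \<noteq> 0 \<Longrightarrow> val (f + g) \<ge> min (val f) (val g)"
  using valuation by (simp add: is_valuation_def val_def embed_add flip: embed_eq_0_iff)

text \<open>Twice \<open>val (- 1)\<close> is \<open>val 1 = 0\<close>, so a sign has value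
  0.\<close>

lemma val_uminus: "f \<noteq> 0 \<Longrightarrow> val (- f) = val f"
  using val_mult[of "- 1" "- 1"] val_mult[of "- 1" f] by simp

text \<open>The ultrametric bound is applied to \<open>f + g\<close> and, in reverse, to
  \<open>f = (f + g) - g\<close>.\<close>

lemma val_add_eq:
  assumes "f \<noteq> 0" "g \<noteq> 0" "val f < val g"
  shows "val (f + g) = val f"
proof -
  \<comment> \<open>A vanishing sum would give \<open>f = - g\<close> and hence equal values; the
    value at 0 is unconstrained, so this case has to be excluded.\<close>
  have nz: "f + g \<noteq> 0"
    using assms val_uminus[of g] by (metis add_eq_0_iff2 less_irrefl)
  have "val f \<le> val (f + g)"
    using val_add[OF assms(1,2) nz] assms(3) by simp
  moreover have "val f \<ge> min (val (f + g)) (val g)"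
    using val_add[OF nz, of "- g"] assms by (simp add: val_uminus)
  ultimately show ?thesis
    using assms(3) by linarith
qed

lemma \<nu>_local_nonneg:
  assumes "g \<notin> max_ideal_XY" "f \<noteq> 0"
  shows "\<nu> (embed f / embed g) \<ge> 0"
proof -
  have "g \<noteq> 0"
    using assms(1) zero_in_max_ideal by blast
  moreover have "embed f / embed g \<in> localize UNIV max_ideal_XY"
    unfolding localize_def using assms by blast
  then have "embed f / embed g \<in> valuation_ring \<nu>"
    using dominates by (auto simp: dominates_def)
  ultimately show ?thesis
    using assms(2) by (simp add: valuation_ring_def)
qed

lemma val_nonneg: "f \<noteq> 0 \<Longrightarrow> val f \<ge> 0"
  using \<nu>_local_nonneg[of 1 f] coeff_0_0_max_ideal[of 1] by (auto simp: val_def)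

text \<open>Both \<open>g\<close> and its inverse lie in the local ring, so both values are
  nonnegative.\<close>

lemma val_unit:
  assumes "g \<notin> max_ideal_XY"
  shows "val g = 0"
proof -
  have "g \<noteq> 0"
    using assms zero_in_max_ideal by blast
  then show ?thesis
    using \<nu>_local_nonneg[OF assms, of 1] val_nonneg[of g]
    by (simp add: \<nu>_divide \<nu>_1 val_def)
qed

text \<open>An inverse \<open>a / g\<close> of \<open>f\<close> in the local ring would give
  \<open>g = f * a\<close>, which lies in the maximal ideal. So \<open>f\<close> is a non-unit and
  domination applies.\<close>

lemma val_max_ideal_pos:
  assumes "f \<in> max_ideal_XY" "f \<noteq> 0"
  shows "val f > 0"
proof -
  have one: "1 \<notin> max_ideal_XY"
    using coeff_0_0_max_ideal[of 1] by auto
  then have "embed f / embed 1 \<in> localize UNIV max_ideal_XY"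
    unfolding localize_def by blast
  moreover have "embed f * w \<noteq> 1" if w: "w \<in> localize UNIV max_ideal_XY" for w
  proof
    assume eq: "embed f * w = 1"
    obtain a g where "w = embed a / embed g" "g \<notin> max_ideal_XY"
      using w by (auto simp: localize_def)
    moreover from this have "g \<noteq> 0"
      using zero_in_max_ideal by blast
    ultimately have "embed (f * a) = embed g" "g \<notin> max_ideal_XY"
      using eq by (auto simp: embed_mult)
    then show False
      using max_ideal_XY_mult[OF assms(1)] by (auto simp: embed_eq_iff)
  qed
  ultimately have "embed f \<in> nonunits (localize UNIV max_ideal_XY)"
    by (auto simp: nonunits_def)
  then have "embed f \<in> valuation_ideal \<nu>"
    using dominates by (auto simp: dominates_def)
  then show ?thesis
    using assms(2) by (simp add: valuation_ideal_def val_def)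
qed

text \<open>Here \<open>p\<close> is \<open>X\<close> to the power \<open>l\<close> times a
  \<open>q\<close> with nonzero constant term, and such a \<open>q\<close> is a unit of the local
  ring. The nonzero coefficient at \<open>l\<close> later shows how the group acts on this
  monomial.\<close>

lemma val_const:
  assumes "p \<noteq> 0"
  obtains l where "coeff p l \<noteq> 0" "val [:p:] = of_nat l * val varX"
proof -
  define l where "l = order 0 p"
  obtain q where q: "p = [:0, 1:] ^ l * q" "\<not> [:0, 1:] dvd q"
    using order_decomp[OF assms, of 0] by (auto simp: l_def)
  have q0: "coeff q 0 \<noteq> 0"
    using q(2) poly_eq_0_iff_dvd[of q 0] by (simp add: poly_0_coeff_0)
  have "p = monom 1 l * q"
    using q(1) by (simp add: monom_altdef)
  then have "coeff p l \<noteq> 0"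
    using q0 by (simp add: coeff_monom_mult)
  moreover have "[:p:] = varX ^ l * [:q:]"
  proof -
    have "[:a:] ^ l = [:a ^ l:]" for a :: "'a poly"
      by (induction l) (simp_all add: one_pCons)
    then show ?thesis
      by (simp add: q(1) varX_def)
  qed
  moreover have "[:q:] \<notin> max_ideal_XY"
    using coeff_0_0_max_ideal[of "[:q:]"] q0 by auto
  moreover have "q \<noteq> 0" "varX \<noteq> (0 :: 'a poly poly)"
    using q0 by (auto simp: varX_def)
  ultimately show ?thesis
    using that by (simp add: val_mult val_power val_unit del: smult_conv_map_poly mult_pCons_right)
qed

end

section \<open>Values along a generating sequence\<close>

locale cutkosky_vinh_sequence = dominating_valuation \<nu>
  for \<nu> :: "'a::field poly poly fract \<Rightarrow> rat" +
  fixes Q :: "nat \<Rightarrow> 'a poly poly"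
  assumes generating: "generating_sequence \<nu> Q"
begin

abbreviation mb :: "nat \<Rightarrow> nat" where
  "mb \<equiv> mbar \<nu> Q"

abbreviation \<gamma> :: "nat \<Rightarrow> rat" where
  "\<gamma> \<equiv> gam \<nu> Q"

definition d :: "nat \<Rightarrow> nat" where
  "d l = (\<Prod>k = 1..<l. mb k)"

text \<open>For \<open>l \<ge> 1\<close> the number \<open>mb l\<close> is the order of
  \<open>\<gamma> l\<close> modulo this group.\<close>

definition lower_group :: "nat \<Rightarrow> rat set" where
  "lower_group l = {\<Sum>k<l. \<gamma> k * of_int (z k) | z. True}"

text \<open>\<open>digit e k\<close> for \<open>k \<ge> 1\<close> are the digits of \<open>e\<close> in the mixed radix system with place
  values \<open>d k\<close>, so that \<open>e\<close> is the degree in \<open>Y\<close> of the product of the \<open>Q k ^ digit e k\<close>.\<close>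

definition digit :: "nat \<Rightarrow> nat \<Rightarrow> nat" where
  "digit e k = (e div d k) mod mb k"

lemma Q_0: "Q 0 = varX" and Q_1: "Q 1 = varY"
  using generating by (simp_all add: generating_sequence_def)

lemma \<gamma>_eq: "\<gamma> k = val (Q k)"
  by (simp add: gam_def val_def)

lemma Q_Suc:
  assumes "l \<ge> 1"
  obtains c s where "\<And>k. 1 \<le> k \<Longrightarrow> k < l \<Longrightarrow> c k < mb k"
    "Q (Suc l) = Q l ^ mb l - const2 s * (\<Prod>k<l. Q k ^ c k)"
  using generating assms unfolding generating_sequence_def by blast

lemma \<gamma>_Suc: "l \<ge> 1 \<Longrightarrow> \<gamma> (Suc l) > of_nat (mb l) * \<gamma> l"
  using generating unfolding generating_sequence_def by blast

lemma \<gamma>_0_pos: "\<gamma> 0 > 0"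
  unfolding \<gamma>_eq Q_0 by (rule val_max_ideal_pos[OF varX_in_max_ideal]) (simp add: varX_def)

lemma \<gamma>_1_pos: "\<gamma> 1 > 0"
  unfolding \<gamma>_eq Q_1 by (rule val_max_ideal_pos[OF varY_in_max_ideal]) (simp add: varY_def)

section \<open>The orders \<open>mb l\<close> of the values\<close>

lemma mbar_eq: "mb l = (LEAST q. q > 0 \<and> of_nat q * \<gamma> l \<in> lower_group l)"
  by (simp add: mbar_def lower_group_def)

lemma
  assumes "l \<ge> 1"
  shows mbar_pos: "mb l > 0" and mbar_lower: "of_nat (mb l) * \<gamma> l \<in> lower_group l"
proof -
  \<comment> \<open>Values are rational, so the denominator of
    \<open>\<gamma> l / \<gamma> 0\<close> already carries \<open>\<gamma> l\<close> into the
    multiples of \<open>\<gamma> 0\<close>; the set under \<open>LEAST\<close> is nonempty.\<close>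
  obtain p q where pq: "quotient_of (\<gamma> l / \<gamma> 0) = (p, q)"
    by fastforce
  have q: "q > 0" "\<gamma> l / \<gamma> 0 = of_int p / of_int q"
    using pq quotient_of_denom_pos quotient_of_div by blast+
  have "of_nat (nat q) * \<gamma> l = \<gamma> 0 * of_int p"
    using q \<gamma>_0_pos by (simp add: field_simps)
  also have "\<dots> = (\<Sum>k<l. \<gamma> k * of_int (if k = 0 then p else 0))"
    using assms by (simp add: if_distrib sum.delta cong: if_cong)
  also have "\<dots> \<in> lower_group l"
    unfolding lower_group_def by (intro CollectI exI[of _ "\<lambda>k. if k = 0 then p else 0"]) simp
  finally have "nat q > 0 \<and> of_nat (nat q) * \<gamma> l \<in> lower_group l"
    using q by simp
  then have "mb l > 0 \<and> of_nat (mb l) * \<gamma> l \<in> lower_group l"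
    unfolding mbar_eq by (rule LeastI)
  then show "mb l > 0" "of_nat (mb l) * \<gamma> l \<in> lower_group l"
    by auto
qed

lemma not_lower_below_mbar:
  assumes "0 < q" "q < mb l"
  shows "of_nat q * \<gamma> l \<notin> lower_group l"
  using not_less_Least[of q "\<lambda>q. q > 0 \<and> of_nat q * \<gamma> l \<in> lower_group l"] assms
  by (simp add: mbar_eq)

section \<open>Degrees in \<open>Y\<close> and mixed radix expansions\<close>

lemma d_pos: "d l > 0"
  unfolding d_def by (intro prod_pos) (simp add: mbar_pos)

lemma d_1: "d (Suc 0) = 1"
  by (simp add: d_def)

lemma d_Suc: "l \<ge> 1 \<Longrightarrow> d (Suc l) = d l * mb l"
  by (simp add: d_def prod.atLeastLessThan_Suc)

text \<open>The lower places together contribute less than one unit of the top place, and the top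
  digit leaves room for one more unit.\<close>

lemma sum_digits_bound:
  assumes "\<And>k. 1 \<le> k \<Longrightarrow> k \<le> L \<Longrightarrow> c k < mb k"
  shows "(\<Sum>k=1..L. c k * d k) < d (Suc L)"
  using assms
proof (induction L)
  case 0
  then show ?case by (simp add: d_1)
next
  case (Suc L)
  then have "(\<Sum>k=1..L. c k * d k) < d (Suc L)"
    by simp
  moreover have "Suc (c (Suc L)) * d (Suc L) \<le> mb (Suc L) * d (Suc L)"
    using Suc.prems[of "Suc L"] by (intro mult_right_mono) auto
  ultimately show ?case
    by (simp add: d_Suc[of "Suc L"] mult.commute)
qed

text \<open>For \<open>e < d (Suc L)\<close> this says that the digits recover
  \<open>e\<close>.\<close>

lemma sum_digits: "(\<Sum>k=1..L. digit e k * d k) = e mod d (Suc L)"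
proof (induction L)
  case (Suc L)
  then show ?case
    by (simp add: d_Suc[of "Suc L"] digit_def mod_mult2_eq)
qed (simp add: d_1)

lemma digit_less: "k \<ge> 1 \<Longrightarrow> digit e k < mb k"
  by (simp add: digit_def mbar_pos)

lemma degree_monic_prod_Q:
  assumes "\<And>k. k \<in> S \<Longrightarrow> lead_coeff (Q k) = 1" "finite S"
  shows "lead_coeff (\<Prod>k\<in>S. Q k ^ c k) = 1"
    and "degree (\<Prod>k\<in>S. Q k ^ c k) = (\<Sum>k\<in>S. c k * degree (Q k))"
proof -
  show "lead_coeff (\<Prod>k\<in>S. Q k ^ c k) = 1"
    using assms(1) by (simp add: lead_coeff_prod lead_coeff_power)
  have "Q k ^ c k \<noteq> 0" if "k \<in> S" for k
    using assms(1)[OF that] by auto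
  then have "degree (\<Prod>k\<in>S. Q k ^ c k) = (\<Sum>k\<in>S. degree (Q k ^ c k))"
    by (intro degree_prod_eq_sum_degree) auto
  also have "\<dots> = (\<Sum>k\<in>S. c k * degree (Q k))"
  proof (intro sum.cong refl degree_power_eq)
    show "Q k \<noteq> 0" if "k \<in> S" for k
      using assms(1)[OF that] by auto
  qed
  finally show "degree (\<Prod>k\<in>S. Q k ^ c k) = (\<Sum>k\<in>S. c k * degree (Q k))" .
qed

text \<open>The term subtracted in the recursion has exponents below the radices, so its degree in
  \<open>Y\<close> is less than that of the power of the preceding member, which alone determines
  the leading term.\<close>

lemma Q_monic_degree: "l \<ge> 1 \<Longrightarrow> lead_coeff (Q l) = 1 \<and> degree (Q l) = d l"
proof (induction l rule: less_induct)
  case (less l)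
  show ?case
  proof (cases "l = 1")
    case True
    then show ?thesis
      by (simp only: Q_1) (simp add: varY_def d_1)
  next
    case False
    with less.prems obtain l' where l': "l = Suc l'" "l' \<ge> 1"
      by (metis One_nat_def Suc_le_D le_eq_less_or_eq less_Suc_eq_le)
    obtain c s where c: "\<And>k. 1 \<le> k \<Longrightarrow> k < l' \<Longrightarrow> c k < mb k"
      and Q: "Q l = Q l' ^ mb l' - const2 s * (\<Prod>k<l'. Q k ^ c k)"
      using Q_Suc[OF l'(2)] l'(1) by metis
    have IH: "lead_coeff (Q k) = 1" "degree (Q k) = d k" if "1 \<le> k" "k < l" for k
      using less.IH[OF that(2,1)] by auto
    \<comment> \<open>Index 0 is treated apart: \<open>c 0\<close> is unbounded, but
      \<open>Q 0 = X\<close> has degree 0 in \<open>Y\<close>.\<close>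
    have split: "{..<l'} = insert 0 {1..l' - 1}"
      using l'(2) by auto
    have "degree (const2 s * (\<Prod>k<l'. Q k ^ c k))
        \<le> degree (const2 s) + degree (\<Prod>k<l'. Q k ^ c k)"
      by (rule degree_mult_le)
    also have "degree (\<Prod>k<l'. Q k ^ c k)
        \<le> degree (Q 0 ^ c 0) + degree (\<Prod>k=1..l'-1. Q k ^ c k)"
      unfolding split by (simp add: degree_mult_le)
    also have "degree (\<Prod>k=1..l'-1. Q k ^ c k) = (\<Sum>k=1..l'-1. c k * degree (Q k))"
      by (intro degree_monic_prod_Q IH) (use l' in auto)
    also have "\<dots> = (\<Sum>k=1..l'-1. c k * d k)"
      by (intro sum.cong) (auto simp: IH l')
    also have "(\<Sum>k=1..l'-1. c k * d k) < d (Suc (l' - 1))"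
      using c l'(2) by (intro sum_digits_bound) auto
    also have "degree (Q 0 ^ c 0) = 0"
      by (simp add: Q_0 varX_def degree_power_eq)
    also have "degree (const2 s) = 0"
      by (simp add: const2_def)
    finally have less: "degree (const2 s * (\<Prod>k<l'. Q k ^ c k)) < d l'"
      using l'(2) by simp
    have lc: "lead_coeff (Q l' ^ mb l') = 1"
      using IH l' by (simp add: lead_coeff_power)
    have deg: "degree (Q l' ^ mb l') = d l"
      using IH[of l'] l' by (subst degree_power_eq) (auto simp: d_Suc)
    have "d l' \<le> d l"
      using l' mbar_pos[OF l'(2)] by (simp add: d_Suc)
    with less have less': "degree (- (const2 s * (\<Prod>k<l'. Q k ^ c k))) < degree (Q l' ^ mb l')"
      by (simp add: deg)
    show ?thesis
      using lead_coeff_add_le[OF less'] degree_add_eq_left[OF less'] deg lc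
      by (simp add: Q add.commute)
  qed
qed

lemma Q_monic: "l \<ge> 1 \<Longrightarrow> lead_coeff (Q l) = 1"
  and degree_Q: "l \<ge> 1 \<Longrightarrow> degree (Q l) = d l"
  using Q_monic_degree by blast+

lemma Q_nonzero: "Q k \<noteq> 0"
  using Q_monic_degree[of k] by (cases "k = 0") (auto simp: Q_0 varX_def)

lemma \<gamma>_pos: "\<gamma> k > 0"
proof -
  have "\<gamma> (Suc l) > 0" for l
  proof (induction l)
    case 0
    then show ?case using \<gamma>_1_pos by simp
  next
    case (Suc l)
    then have "0 \<le> of_nat (mb (Suc l)) * \<gamma> (Suc l)"
      by simp
    also have "\<dots> < \<gamma> (Suc (Suc l))"
      by (rule \<gamma>_Suc) simp
    finally show ?case .
  qed
  then show ?thesis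
    using \<gamma>_0_pos by (cases k) auto
qed

section \<open>Distinctness of the values of monomials\<close>

lemma in_lower_group:
  "of_int z0 * \<gamma> 0 + (\<Sum>k=1..L. of_int (z k) * \<gamma> k) \<in> lower_group (Suc L)"
  unfolding lower_group_def
proof (intro CollectI exI[of _ "\<lambda>k. if k = 0 then z0 else z k"] conjI TrueI)
  show "of_int z0 * \<gamma> 0 + (\<Sum>k=1..L. of_int (z k) * \<gamma> k) =
      (\<Sum>k<Suc L. \<gamma> k * of_int (if k = 0 then z0 else z k))"
    unfolding sum.lessThan_Suc_shift
    by (simp add: sum.atLeast1_atMost_eq mult.commute)
qed

text \<open>If the top digits differed, their difference would be a positive number below
  \<open>mb (Suc L)\<close> carrying \<open>\<gamma> (Suc L)\<close> into the lower group, against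
  minimality. The exponents of \<open>X\<close> stay free, since they only contribute multiples of
  \<open>\<gamma> 0\<close>. Induction handles the lower digits.\<close>

lemma values_inj:
  assumes "of_nat l * \<gamma> 0 + (\<Sum>k=1..L. of_nat (a k) * \<gamma> k) =
      of_nat l' * \<gamma> 0 + (\<Sum>k=1..L. of_nat (b k) * \<gamma> k)"
    and "\<And>k. 1 \<le> k \<Longrightarrow> k \<le> L \<Longrightarrow> a k < mb k" "\<And>k. 1 \<le> k \<Longrightarrow> k \<le> L \<Longrightarrow> b k < mb k"
    and "1 \<le> k" "k \<le> L"
  shows "a k = b k"
  using assms
proof (induction L arbitrary: k)
  case (Suc L)
  \<comment> \<open>Kept general in \<open>a\<close>, \<open>b\<close>, \<open>l\<close>,
    \<open>l'\<close> so that it serves for both orders of the top digits.\<close>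
  have no_excess: False
    if eq: "of_nat l * \<gamma> 0 + (\<Sum>k=1..Suc L. of_nat (a k) * \<gamma> k) =
        of_nat l' * \<gamma> 0 + (\<Sum>k=1..Suc L. of_nat (b k) * \<gamma> k)"
      and lt: "b (Suc L) < a (Suc L)" and bd: "a (Suc L) < mb (Suc L)"
    for a b l l'
  proof -
    have "of_nat (a (Suc L) - b (Suc L)) * \<gamma> (Suc L) =
        of_int (int l' - int l) * \<gamma> 0 + (\<Sum>k=1..L. of_int (int (b k) - int (a k)) * \<gamma> k)"
      using eq lt by (simp add: of_nat_diff algebra_simps sum_subtractf)
    also have "\<dots> \<in> lower_group (Suc L)"
      by (rule in_lower_group)
    finally show False
      using not_lower_below_mbar[of "a (Suc L) - b (Suc L)" "Suc L"] lt bd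
      by (metis less_imp_diff_less zero_less_diff)
  qed
  have top: "a (Suc L) = b (Suc L)"
    using no_excess[OF Suc.prems(1)] no_excess[OF Suc.prems(1)[symmetric]]
      Suc.prems(2)[of "Suc L"] Suc.prems(3)[of "Suc L"] by (metis le_add1 le_refl linorder_neqE_nat plus_1_eq_Suc)
  show ?case
  proof (cases "k = Suc L")
    case False
    show ?thesis
      using Suc.prems top False by (intro Suc.IH) auto
  qed (use top in simp)
qed simp

section \<open>Values of invariant polynomials\<close>

lemma eigen_prod:
  assumes "\<And>k. eigenfunction H (Q k)" "(u, v) \<in> H"
  shows "act (u, v) (\<Prod>k=1..L. Q k ^ c k) =
    const2 (v ^ (\<Sum>k=1..L. c k * degree (Q k))) * (\<Prod>k=1..L. Q k ^ c k)"
proof -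
  have "act (u, v) (Q k ^ c k) = const2 (v ^ (c k * degree (Q k))) * Q k ^ c k"
    if "k \<in> {1..L}" for k
  proof -
    have "act (u, v) (Q k) = const2 (v ^ degree (Q k)) * Q k"
      using that by (intro eigenvalue_monic[OF assms] Q_monic) simp
    then show ?thesis
      by (simp add: act_power power_mult_distrib mult.commute[of "c k"] power_mult const2_power)
  qed
  then show ?thesis
    by (simp add: act_prod prod.distrib power_sum const2_prod)
qed

lemma val_prod_Q: "val (\<Prod>k\<in>S. Q k ^ c k) = (\<Sum>k\<in>S. of_nat (c k) * \<gamma> k)"
  by (simp add: val_prod val_power Q_nonzero \<gamma>_eq)

text \<open>Peeling off the leading term in \<open>Y\<close> together with the product of the \<open>Q k\<close> of the same
  degree preserves invariance, and by \<open>values_inj\<close> all the terms obtained have distinct values.\<close>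

lemma value_invariant:
  assumes "\<And>k. eigenfunction H (Q k)"
    and "f \<noteq> 0" "\<And>g. g \<in> H \<Longrightarrow> act g f = f" "degree f < d (Suc L)"
  shows "\<exists>l e. e \<le> degree f \<and> (\<forall>(u, v)\<in>H. u ^ l * v ^ e = 1) \<and>
    val f = of_nat l * \<gamma> 0 + (\<Sum>k=1..L. of_nat (digit e k) * \<gamma> k)"
  using assms(2-)
proof (induction "degree f" arbitrary: f rule: less_induct)
  case less
  define n where "n = degree f"
  define p where "p = lead_coeff f"
  \<comment> \<open>The digits of \<open>n\<close> give the product of the \<open>Q k\<close> whose
    degree in \<open>Y\<close> is exactly \<open>n\<close>.\<close>
  define P where "P = (\<Prod>k=1..L. Q k ^ digit n k)"
  have "p \<noteq> 0"
    using less.prems by (simp add: p_def)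
  have sum_n: "(\<Sum>k=1..L. digit n k * degree (Q k)) = n"
  proof -
    have "(\<Sum>k=1..L. digit n k * degree (Q k)) = (\<Sum>k=1..L. digit n k * d k)"
      by (intro sum.cong) (auto simp: degree_Q)
    also have "\<dots> = n"
      using less.prems(3) by (subst sum_digits) (simp add: n_def)
    finally show ?thesis .
  qed
  have P: "lead_coeff P = 1" "degree P = n"
    using degree_monic_prod_Q[OF Q_monic, of "{1..L}" "digit n"] unfolding P_def sum_n by simp_all
  have "P \<noteq> 0"
    using P(1) by auto
  obtain l where l: "coeff p l \<noteq> 0" "val [:p:] = of_nat l * \<gamma> 0"
    using val_const[OF \<open>p \<noteq> 0\<close>] by (auto simp: \<gamma>_eq Q_0)
  define T where "T = [:p:] * P"
  have T: "T \<noteq> 0" "degree T = n" "coeff T n = p"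
    using \<open>p \<noteq> 0\<close> \<open>P \<noteq> 0\<close> P by (auto simp: T_def degree_mult_eq)
  have val_T: "val T = of_nat l * \<gamma> 0 + (\<Sum>k=1..L. of_nat (digit n k) * \<gamma> k)"
    using val_mult[of "[:p:]" P] \<open>p \<noteq> 0\<close> \<open>P \<noteq> 0\<close> l(2) unfolding T_def P_def
    by (simp only: val_prod_Q pCons_eq_0_iff simp_thms)
  have p_inv: "smult (v ^ n) (pcompose p [:0, u:]) = p" if "(u, v) \<in> H" for u v
    using arg_cong[OF less.prems(2)[OF that], of "\<lambda>f. coeff f n"]
    by (simp add: coeff_act p_def n_def)
  \<comment> \<open>Compare coefficients of \<open>X\<close> to the power \<open>l\<close> in
    \<open>p_inv\<close> and cancel the nonzero \<open>coeff p l\<close>.\<close>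
  have T_char: "\<forall>(u, v)\<in>H. u ^ l * v ^ n = 1"
  proof safe
    fix u v assume "(u, v) \<in> H"
    then have "v ^ n * (u ^ l * coeff p l) = coeff p l"
      using arg_cong[OF p_inv, of u v "\<lambda>p. coeff p l"] by (simp add: coeff_pcompose_scale)
    then show "u ^ l * v ^ n = 1"
      using l(1) by (simp add: mult.commute mult.left_commute)
  qed
  have T_inv: "act g T = T" if "g \<in> H" for g
  proof -
    obtain u v where g: "g = (u, v)" by fastforce
    have "act g T = [:pcompose p [:0, u:]:] * (const2 (v ^ n) * P)"
      using eigen_prod[OF assms(1), of u v "digit n" L] that g
      by (simp only: T_def act_mult act_const P_def sum_n)
    also have "\<dots> = [:smult (v ^ n) (pcompose p [:0, u:]):] * P"
      by (simp add: const2_def mult.commute)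
    finally show ?thesis
      using p_inv that g by (simp add: T_def)
  qed
  show ?case
  proof (cases "f = T")
    case True
    then show ?thesis
      using val_T T_char T(2) by auto
  next
    case False
    define r where "r = f - T"
    have r: "r \<noteq> 0" "f = T + r"
      using False by (auto simp: r_def)
    have "degree r \<le> n"
      using degree_diff_le[of f n T] T(2) by (simp add: r_def n_def)
    moreover have "coeff r n = 0"
      using T(3) by (simp add: r_def p_def n_def)
    ultimately have deg_r: "degree r < n"
      using r(1) by (metis le_neq_implies_less leading_coeff_0_iff)
    have "\<exists>l e. e \<le> degree r \<and> (\<forall>(u, v)\<in>H. u ^ l * v ^ e = 1) \<and>
        val r = of_nat l * \<gamma> 0 + (\<Sum>k=1..L. of_nat (digit e k) * \<gamma> k)"
      using deg_r less.prems T_inv r(1)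
      by (intro less.hyps) (auto simp: n_def r_def act_diff)
    then obtain l' e where e: "e \<le> degree r" "\<forall>(u, v)\<in>H. u ^ l' * v ^ e = 1"
        "val r = of_nat l' * \<gamma> 0 + (\<Sum>k=1..L. of_nat (digit e k) * \<gamma> k)"
      by blast
    \<comment> \<open>Equal values would mean equal digits and hence \<open>n = e\<close>, whereas
      \<open>e \<le> degree r < n\<close>. With distinct values, the value of
      \<open>f = T + r\<close> is the smaller of the two.\<close>
    have "val T \<noteq> val r"
    proof
      assume eq: "val T = val r"
      have "digit n k = digit e k" if "k \<in> {1..L}" for k
        using values_inj[of l "digit n" L l' "digit e" k] eq that by (simp add: val_T e(3) digit_less)
      then have "n mod d (Suc L) = e mod d (Suc L)"
        by (simp flip: sum_digits)
      then show False
        using e(1) deg_r less.prems(3) unfolding n_def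
        by (metis le_less_trans less_irrefl mod_less order.strict_trans)
    qed
    then consider "val f = val T" | "val f = val r"
      using val_add_eq[of T r] val_add_eq[of r T] r T(1)
      by (metis add.commute linorder_neqE)
    then show ?thesis
    proof cases
      case 1
      then show ?thesis using val_T T_char n_def by auto
    next
      case 2
      then show ?thesis using e deg_r n_def
        by (intro exI[of _ l'] exI[of _ e]) auto
    qed
  qed
qed

text \<open>If the degrees \<open>d l\<close> stay bounded, all \<open>\<gamma> l\<close> lie in one cyclic group and hence tend to
  infinity; the remainder of \<open>f\<close> modulo a \<open>Q l\<close> of large value then has the same value as \<open>f\<close>.\<close>

lemma discrete_of_bounded_degree:
  assumes L0: "\<And>k. k > L0 \<Longrightarrow> mb k = 1"
  shows "discrete_valuation \<nu>"
proof -
  obtain D :: int where D: "D > 0" "\<And>k. k \<le> L0 \<Longrightarrow> of_int D * \<gamma> k \<in> \<int>"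
    using rat_in_Ints_common_multiple by blast
  have D_\<gamma>: "of_int D * \<gamma> k \<in> \<int>" for k
  proof (induction k rule: less_induct)
    case (less k)
    show ?case
    proof (cases "k \<le> L0")
      case False
      \<comment> \<open>Since \<open>mb k = 1\<close>, the value \<open>\<gamma> k\<close> is an
        integer combination of earlier ones and brings in no new denominator.\<close>
      then have "\<gamma> k \<in> lower_group k"
        using mbar_lower[of k] L0[of k] by simp
      then obtain z where "\<gamma> k = (\<Sum>i<k. \<gamma> i * of_int (z i))"
        by (auto simp: lower_group_def)
      then have "of_int D * \<gamma> k = (\<Sum>i<k. (of_int D * \<gamma> i) * of_int (z i))"
        by (simp add: sum_distrib_left mult.assoc)
      also have "\<dots> \<in> \<int>"
        using less by (intro Ints_sum Ints_mult[OF _ Ints_of_int]) simp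
      finally show ?thesis .
    qed (use D in auto)
  qed
  have unbounded: "of_int D * \<gamma> (Suc (L0 + n)) \<ge> of_nat n" for n
  proof (induction n)
    case 0
    then show ?case using D(1) \<gamma>_pos[of "Suc L0"] by simp
  next
    case (Suc n)
    obtain a b where ab: "of_int D * \<gamma> (Suc (L0 + n)) = of_int a"
        "of_int D * \<gamma> (Suc (L0 + Suc n)) = of_int b"
      using D_\<gamma> by (metis Ints_cases)
    have "\<gamma> (Suc (L0 + n)) < \<gamma> (Suc (L0 + Suc n))"
      using \<gamma>_Suc[of "Suc (L0 + n)"] L0[of "Suc (L0 + n)"] by simp
    then have "of_int D * \<gamma> (Suc (L0 + n)) < of_int D * \<gamma> (Suc (L0 + Suc n))"
      using D(1) by (intro mult_strict_left_mono) auto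
    \<comment> \<open>A strict increase between integers is at least 1.\<close>
    then have "a + 1 \<le> b"
      using ab by simp
    then have "of_int a + 1 \<le> (of_int b :: rat)"
      by (metis of_int_1 of_int_add of_int_le_iff)
    then show ?case
      using Suc ab by simp
  qed
  have d_const: "d (Suc (L0 + n)) = d (Suc L0)" for n
    by (induction n) (simp_all add: d_Suc L0)
  have D_val: "of_int D * val f \<in> \<int>" if "f \<noteq> 0" for f
  proof -
    \<comment> \<open>Chosen so that \<open>Q l\<close> has larger value than \<open>f\<close>, by
      \<open>unbounded\<close>.\<close>
    define n where "n = nat \<lceil>of_int D * val f + 1\<rceil>"
    define l where "l = Suc (L0 + n)"
    have "of_int D * val f < of_nat n"
      unfolding n_def by linarith
    also have "\<dots> \<le> of_int D * \<gamma> l"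
      unfolding l_def by (rule unbounded)
    finally have big: "val f < val (Q l)"
      using D(1) by (simp add: \<gamma>_eq)
    have Ql: "lead_coeff (Q l) = 1" "degree (Q l) = d (Suc L0)"
      using Q_monic_degree[of l] d_const by (auto simp: l_def)
    obtain q r where qr: "f = Q l * q + r" "r = 0 \<or> degree r < degree (Q l)"
      using monic_division[OF Ql(1)] by blast
    have big': "q \<noteq> 0 \<Longrightarrow> val f < val (Q l * q)"
      using big val_nonneg[of q] by (simp add: val_mult Q_nonzero)
    \<comment> \<open>Otherwise \<open>f\<close> would be a multiple of \<open>Q l\<close> and its
      value would exceed itself.\<close>
    have "r \<noteq> 0"
      using big' qr \<open>f \<noteq> 0\<close> by auto
    have "val r = val f"
    proof (cases "q = 0")
      case False
      have "r = f + - (Q l * q)"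
        using qr by simp
      then show ?thesis
        using val_add_eq[of f "- (Q l * q)"] big' False \<open>f \<noteq> 0\<close> Q_nonzero[of l]
        by (simp add: val_uminus)
    qed (use qr in simp)
    \<comment> \<open>With the empty set in place of \<open>H\<close>, every polynomial is
      invariant, so \<open>value_invariant\<close> describes the value of any \<open>r\<close> of
      small degree.\<close>
    moreover obtain a e where "val r = of_nat a * \<gamma> 0 + (\<Sum>k=1..L0. of_nat (digit e k) * \<gamma> k)"
      using value_invariant[of "{}" r L0] \<open>r \<noteq> 0\<close> qr(2) Ql by (auto simp: eigenfunction_def)
    ultimately have v: "val f = of_nat a * \<gamma> 0 + (\<Sum>k=1..L0. of_nat (digit e k) * \<gamma> k)"
      by simp
    have "of_int D * val f = of_nat a * (of_int D * \<gamma> 0) +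
        (\<Sum>k=1..L0. of_nat (digit e k) * (of_int D * \<gamma> k))"
      by (simp add: v sum_distrib_left distrib_left mult_ac)
    also have "\<dots> \<in> \<int>"
      using D_\<gamma> by (intro Ints_add Ints_sum Ints_mult[OF Ints_of_nat]) auto
    finally show ?thesis .
  qed
  have D_\<nu>: "of_int D * \<nu> z \<in> \<int>" if "z \<noteq> 0" for z
  proof -
    obtain f g where fg: "g \<noteq> 0" "z = embed f / embed g"
      by (rule fract_eq_embed_quotient)
    with that have "f \<noteq> 0" by auto
    then have "of_int D * \<nu> z = of_int D * val f - of_int D * val g"
      using fg by (simp add: \<nu>_divide val_def algebra_simps)
    then show ?thesis
      using D_val fg \<open>f \<noteq> 0\<close> by simp
  qed
  show ?thesis
    unfolding discrete_valuation_def
  proof (rule additive_subgroup_discrete[OF D(1)])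
    show "of_int D * z \<in> \<int>" if "z \<in> value_group \<nu>" for z
      using that D_\<nu> by (auto simp: value_group_def)
    show "y - z \<in> value_group \<nu>" if yz: "y \<in> value_group \<nu>" "z \<in> value_group \<nu>" for y z
    proof -
      obtain f where f: "f \<noteq> 0" "y = \<nu> f"
        using yz(1) by (auto simp: value_group_def)
      obtain g where g: "g \<noteq> 0" "z = \<nu> g"
        using yz(2) by (auto simp: value_group_def)
      have "y - z = \<nu> (f / g)"
        using f g by (simp add: \<nu>_divide)
      with f g show ?thesis
        by (auto simp: value_group_def)
    qed
    show "\<gamma> 0 \<in> value_group \<nu>"
      using Q_nonzero by (auto simp: value_group_def gam_def)
    show "\<gamma> 0 > 0"
      by (rule \<gamma>_0_pos)
  qed
qed

text \<open>Non-discreteness yields, beyond every index, some \<open>k\<close> with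
  \<open>mb k \<ge> 2\<close>; there \<open>d\<close> at least doubles, which is enough to pass from
  \<open>e\<close> to \<open>Suc e\<close>.\<close>

lemma d_unbounded:
  assumes "\<not> discrete_valuation \<nu>"
  shows "\<exists>L. e < d (Suc L)"
proof (induction e)
  case 0
  then show ?case using d_pos by blast
next
  case (Suc e)
  then obtain L where L: "e < d (Suc L)" by blast
  obtain k where k: "k > L" "mb k \<noteq> 1"
    using discrete_of_bounded_degree assms by blast
  have mono: "d (Suc L) \<le> d (Suc (L + n))" for n
  proof (induction n)
    case (Suc n)
    have "d (Suc (L + n)) * 1 \<le> d (Suc (L + n)) * mb (Suc (L + n))"
      using mbar_pos[of "Suc (L + n)"] by (intro mult_left_mono) auto
    also have "\<dots> = d (Suc (L + Suc n))"
      by (simp add: d_Suc)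
    finally show ?case
      using Suc by simp
  qed simp
  have "2 \<le> mb k"
    using k mbar_pos[of k] by linarith
  then have "d k * 2 \<le> d (Suc k)"
    using k by (simp add: d_Suc)
  moreover have "d (Suc L) \<le> d k"
    using mono[of "k - Suc L"] k by simp
  moreover note d_pos[of k]
  ultimately have "Suc e < d (Suc k)"
    using L by linarith
  then show ?case by blast
qed

section \<open>The value semigroup of the localized ring of invariants\<close>

lemma value_semigroup_invariants:
  assumes eigen: "\<And>k. eigenfunction H (Q k)" and "\<not> discrete_valuation \<nu>"
  defines "A \<equiv> invariant_ring H"
  shows "value_semigroup \<nu> (localize A (max_ideal_XY \<inter> A)) =
    {of_nat l * \<gamma> 0 + (\<Sum>k=1..r. of_nat (js k) * \<gamma> k) | l r js.
       (\<forall>k\<in>{1..r}. js k < mb k) \<and>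
       (\<forall>(u, v)\<in>H. u ^ l * v ^ (\<Sum>k=1..r. js k * degree (Q k)) = 1)}" (is "_ = ?S")
proof (intro equalityI subsetI)
  fix w assume "w \<in> value_semigroup \<nu> (localize A (max_ideal_XY \<inter> A))"
  then obtain f g where fg: "w = \<nu> (embed f / embed g)" "embed f / embed g \<noteq> 0"
      "f \<in> A" "g \<in> A" "g \<notin> max_ideal_XY"
    by (fastforce simp: value_semigroup_def localize_def)
  then have nz: "f \<noteq> 0" "g \<noteq> 0"
    by auto
  have "w = val f"
    using fg nz val_unit[of g] by (simp add: \<nu>_divide val_def)
  obtain L where L: "degree f < d (Suc L)"
    using d_unbounded[OF assms(2)] by blast
  have "\<And>g. g \<in> H \<Longrightarrow> act g f = f"
    using fg(3) by (auto simp: A_def invariant_ring_def)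
  then obtain l e where le: "e \<le> degree f" "\<forall>(u, v)\<in>H. u ^ l * v ^ e = 1"
      "val f = of_nat l * \<gamma> 0 + (\<Sum>k=1..L. of_nat (digit e k) * \<gamma> k)"
    using value_invariant[OF eigen nz(1) _ L] by blast
  have "(\<Sum>k=1..L. digit e k * degree (Q k)) = (\<Sum>k=1..L. digit e k * d k)"
    by (intro sum.cong) (auto simp: degree_Q)
  also have "\<dots> = e"
    using le(1) L by (subst sum_digits) simp
  finally show "w \<in> ?S"
    using le \<open>w = val f\<close> digit_less
    by (intro CollectI exI[of _ l] exI[of _ L] exI[of _ "digit e"]) auto
next
  fix w assume "w \<in> ?S"
  then obtain l r js where w: "w = of_nat l * \<gamma> 0 + (\<Sum>k=1..r. of_nat (js k) * \<gamma> k)"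
    and char: "\<forall>(u, v)\<in>H. u ^ l * v ^ (\<Sum>k=1..r. js k * degree (Q k)) = 1"
    by blast
  define P where "P = (\<Prod>k=1..r. Q k ^ js k)"
  \<comment> \<open>This monomial, over the denominator 1, realizes \<open>w\<close>; its eigenvalue
    at \<open>(u, v)\<close> is the expression in \<open>char\<close>, hence 1.\<close>
  define f where "f = varX ^ l * P"
  have nz: "varX ^ l \<noteq> (0 :: 'a poly poly)" "P \<noteq> 0"
    using Q_nonzero[of 0] by (simp_all add: Q_0 P_def Q_nonzero)
  have "val f = w"
    using nz Q_nonzero[of 0]
    by (simp add: f_def val_mult val_power w Q_0) (simp add: P_def val_prod_Q \<gamma>_eq Q_0)
  have "act g f = f" if "g \<in> H" for g
  proof -
    obtain u v where g: "g = (u, v)" by fastforce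
    have "act g f = const2 (u ^ l * v ^ (\<Sum>k=1..r. js k * degree (Q k))) * f"
      using eigen_prod[OF eigen, of u v js r] that g
      by (simp add: f_def act_mult act_varX_power P_def const2_mult mult_ac)
    then show ?thesis
      using char that g by auto
  qed
  then have "f \<in> A" "1 \<in> A" "1 \<notin> max_ideal_XY"
    using coeff_0_0_max_ideal[of 1] by (auto simp: A_def invariant_ring_def)
  then have "embed f / embed 1 \<in> localize A (max_ideal_XY \<inter> A)"
    unfolding localize_def by blast
  then show "w \<in> value_semigroup \<nu> (localize A (max_ideal_XY \<inter> A))"
    using \<open>val f = w\<close> nz by (auto simp: value_semigroup_def val_def f_def)
qed

end

text \<open>Different pairs of exponents may name the same group element; this is harmless because
  the condition is universal on both sides.\<close>

lemma grpH_character_iff: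
  fixes \<alpha> \<beta> :: "'a::field"
  shows "(\<forall>(u, v)\<in>grpH \<alpha> \<beta> i j t x. u ^ l * v ^ e = 1) \<longleftrightarrow>
    (\<forall>a b :: int. [b = a * int x] (mod int t) \<longrightarrow>
       \<alpha> powi (int l * a * int i) * \<beta> powi (b * int j * int e) = 1)"
proof -
  have "(\<alpha> powi (a * int i)) ^ l = \<alpha> powi (int l * a * int i)" for a
    by (simp add: mult_ac flip: power_int_of_nat power_int_mult)
  moreover have "(\<beta> powi (b * int j)) ^ e = \<beta> powi (b * int j * int e)" for b
    by (simp flip: power_int_of_nat power_int_mult)
  ultimately show ?thesis
    unfolding grpH_def by fastforce
qed

theorem theorem3p1:
  fixes \<alpha> \<beta> :: "'a :: {alg_closed_field, field_char_0}"
    and m n i j t x :: nat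
    and \<nu> :: "'a poly poly fract \<Rightarrow> rat"
    and Q :: "nat \<Rightarrow> 'a poly poly"
    and A \<nn> :: "'a poly poly set"
  assumes "m > 0" and "n > 0"
    and "primitive_root_of_unity m \<alpha>" and "primitive_root_of_unity n \<beta>"
    and "admissible m n i j t x"
    and "is_valuation \<nu>" and "rational_rank \<nu> = 1" and "\<not> discrete_valuation \<nu>"
    and "dominates \<nu> (localize UNIV max_ideal_XY)"
    and "generating_sequence \<nu> Q"
    and "\<And>l. eigenfunction (grpH \<alpha> \<beta> i j t x) (Q l)"
    and "A = invariant_ring (grpH \<alpha> \<beta> i j t x)"
    and "\<nn> = max_ideal_XY \<inter> A"
  shows "value_semigroup \<nu> (localize A \<nn>) =
    {of_nat l * gam \<nu> Q 0 + (\<Sum>k=1..r. of_nat (js k) * gam \<nu> Q k) | l r (js :: nat \<Rightarrow> nat).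
       (\<forall>k\<in>{1..r}. js k < mbar \<nu> Q k) \<and>
       (\<forall>a b :: int. [b = a * int x] (mod int t) \<longrightarrow>
          \<alpha> powi (int l * a * int i) *
          \<beta> powi (b * int j * int (\<Sum>k=1..r. js k * degree (Q k))) = 1)}"
proof -
  interpret cutkosky_vinh_sequence \<nu> Q
    using assms by unfold_locales
  show ?thesis
    unfolding assms(12,13)
    by (subst value_semigroup_invariants[OF assms(11,8)]) (simp only: grpH_character_iff)
qed

end
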